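(* For any integers $v\ge w\ge t\ge 2$, $$M_t(w,v)\le \frac{\binom{v}{\lceil w/t^2\rceil}-\binom{w-1}{\lceil w/t^2\rceil}}{\binom{w-1}{\lceil w/t^2\rceil-1}}.$$
   Context: A set system is a pair $(\mathcal{X},\mathcal{B})$ where $\mathcal{X}$ is a finite set of points and $\mathcal{B}$ is a collection (set) of subsets of $\mathcal{X}$ called blocks; its size is $|\mathcal{B}|$. $\binom{\mathcal{X}}{w}$ denotes the collection of all $w$-subsets of $\mathcal{X}$. A $t$-traceability scheme $t$-TS$(w,v)$ is a set system $(\mathcal{X},\mathcal{B})$ with $|\mathcal{X}|=v$ and $\mathcal{B}\subseteq\binom{\mathcal{X}}{w}$ such that for every choice of $s$ blocks $B_1,\ldots,B_s\in\mathcal{B}$ with $1\le s\le t$ and for any $w$-subset $T\subseteq\bigcup_{1\le j\le s}B_j$, there does not exist a block $B\in\mathcal{B}\setminus\{B_1,\ldots,B_s\}$ such that $|T\cap B|\ge|T\cap B_j|$ for all $1\le j\le s$. $M_t(w,v)$ denotes the maximum size of a $t$-TS$(w,v)$. *)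

theory Defs
  imports Complex_Main "HOL-Library.Ramsey"
begin

definition set_system :: "'a set \<Rightarrow> 'a set set \<Rightarrow> bool" where
  "set_system X \<B> \<longleftrightarrow> finite X \<and> \<B> \<subseteq> Pow X"

(* The blocks C 1, ..., C s need not be distinct: repeating a block changes neither the union
   nor the comparisons, so this agrees with choosing at most t distinct blocks. *)
definition traceability_scheme :: "nat \<Rightarrow> nat \<Rightarrow> nat \<Rightarrow> 'a set \<Rightarrow> 'a set set \<Rightarrow> bool" where
  "traceability_scheme t w v X \<B> \<longleftrightarrow>
     set_system X \<B> \<and> card X = v \<and> \<B> \<subseteq> nsets X w \<and>
     (\<forall>s C T. 1 \<le> s \<longrightarrow> s \<le> t \<longrightarrow> (\<forall>j\<in>{1..s}. C j \<in> \<B>) \<longrightarrow>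
        T \<in> nsets (\<Union>j\<in>{1..s}. C j) w \<longrightarrow>
        \<not> (\<exists>B \<in> \<B> - C ` {1..s}. \<forall>j\<in>{1..s::nat}. card (T \<inter> B) \<ge> card (T \<inter> C j)))"

(* Point sets are taken inside the naturals. This is no restriction: card_le_max_TS_size below
   bounds the size of schemes over an arbitrary point type. *)
definition max_TS_size :: "nat \<Rightarrow> nat \<Rightarrow> nat \<Rightarrow> nat" where
  "max_TS_size t w v = Max {card \<B> | (X :: nat set) \<B>. traceability_scheme t w v X \<B>}"

lemma finite_TS_sizes:
  "finite {card \<B> | (X :: 'a set) \<B>. traceability_scheme t w v X \<B>}"
proof (rule finite_subset)
  show "{card \<B> | (X :: 'a set) \<B>. traceability_scheme t w v X \<B>} \<subseteq> {..2 ^ v}"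
  proof
    fix n assume "n \<in> {card \<B> | (X :: 'a set) \<B>. traceability_scheme t w v X \<B>}"
    then obtain X :: "'a set" and \<B> where n: "n = card \<B>" and "traceability_scheme t w v X \<B>"
      by blast
    then have "finite X" "card X = v" "\<B> \<subseteq> Pow X"
      by (auto simp: traceability_scheme_def set_system_def)
    then show "n \<in> {..2 ^ v}"
      using n card_mono[of "Pow X" \<B>] by (simp add: card_Pow)
  qed
qed simp

lemma max_TS_size_attained:
  "\<exists>(X :: nat set) \<B>. traceability_scheme t w v X \<B> \<and> card \<B> = max_TS_size t w v"
proof -
  have "traceability_scheme t w v {..<v} {}"
    by (auto simp: traceability_scheme_def set_system_def)
  then have "{card \<B> | (X :: nat set) \<B>. traceability_scheme t w v X \<B>} \<noteq> {}"
    by blast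
  from Max_in[OF finite_TS_sizes this] show ?thesis
    unfolding max_TS_size_def by force
qed

lemma traceability_scheme_image:
  fixes f :: "'a \<Rightarrow> 'b"
  assumes ts: "traceability_scheme t w v X \<B>" and inj: "inj_on f X"
  shows "traceability_scheme t w v (f ` X) ((`) f ` \<B>)"
proof -
  have X: "finite X" "card X = v" and B: "\<B> \<subseteq> nsets X w" and sub: "\<And>B. B \<in> \<B> \<Longrightarrow> B \<subseteq> X"
    using ts by (auto simp: traceability_scheme_def set_system_def)
  have cardf: "card (f ` A) = card A" if "A \<subseteq> X" for A
    using inj that by (meson card_image inj_on_subset)
  have nsets: "(`) f ` \<B> \<subseteq> nsets (f ` X) w"
    using B by (auto simp: nsets_def cardf subset_iff)
  have False
    if s: "1 \<le> s" "s \<le> t" and C: "\<forall>j\<in>{1..s}. C j \<in> (`) f ` \<B>"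
      and T: "T \<in> nsets (\<Union>j\<in>{1..s}. C j) w"
      and A: "A \<in> (`) f ` \<B> - C ` {1..s}"
      and le: "\<forall>j\<in>{1..s}. card (T \<inter> A) \<ge> card (T \<inter> C j)"
    for s C T A
  proof -
    from C have "\<forall>j\<in>{1..s}. \<exists>D. D \<in> \<B> \<and> C j = f ` D" by blast
    then obtain D where D: "\<And>j. j \<in> {1..s} \<Longrightarrow> D j \<in> \<B>" "\<And>j. j \<in> {1..s} \<Longrightarrow> C j = f ` D j"
      by metis
    from A obtain A' where A': "A' \<in> \<B>" "A = f ` A'" by blast
    have DX: "(\<Union>j\<in>{1..s}. D j) \<subseteq> X" using D(1) sub by blast
    have "T \<subseteq> f ` (\<Union>j\<in>{1..s}. D j)"
      unfolding image_UN using T D(2) by (simp add: nsets_def)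
    then obtain S where S: "S \<subseteq> (\<Union>j\<in>{1..s}. D j)" "T = f ` S"
      by (meson subset_image_iff)
    have SX: "S \<subseteq> X" using S DX by blast
    have int: "card (T \<inter> f ` E) = card (S \<inter> E)" if "E \<subseteq> X" for E
      using inj_on_image_Int[OF inj SX that] S(2) cardf[of "S \<inter> E"] SX by auto
    have "S \<in> nsets (\<Union>j\<in>{1..s}. D j) w"
      using S T cardf[OF SX] finite_subset[OF SX X(1)] by (auto simp: nsets_def)
    moreover have "A' \<in> \<B> - D ` {1..s}" using A A' D by auto
    moreover have "\<forall>j\<in>{1..s}. card (S \<inter> A') \<ge> card (S \<inter> D j)"
    proof
      fix j assume j: "j \<in> {1..s}"
      then have "card (T \<inter> C j) \<le> card (T \<inter> A)" using le by blast
      then show "card (S \<inter> D j) \<le> card (S \<inter> A')"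
        using int[OF sub[OF D(1)[OF j]]] int[OF sub[OF A'(1)]] D(2)[OF j] A'(2) by simp
    qed
    moreover have "\<forall>j\<in>{1..s}. D j \<in> \<B>" using D(1) by blast
    ultimately show False
      using conjunct2[OF conjunct2[OF conjunct2[OF ts[unfolded traceability_scheme_def]]],
          rule_format, of s D S] s by blast
  qed
  moreover have "finite (f ` X)" "card (f ` X) = v" "(`) f ` \<B> \<subseteq> Pow (f ` X)"
    using X cardf[of X] sub by auto
  ultimately show ?thesis
    unfolding traceability_scheme_def set_system_def using nsets by blast
qed

lemma card_le_max_TS_size:
  fixes X :: "'a set"
  assumes ts: "traceability_scheme t w v X \<B>"
  shows "card \<B> \<le> max_TS_size t w v"
proof -
  from ts have "finite X" and sub: "\<B> \<subseteq> Pow X"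
    by (auto simp: traceability_scheme_def set_system_def)
  then obtain f :: "'a \<Rightarrow> nat" where f: "inj_on f X"
    using finite_imp_inj_to_nat_seg[of X] by metis
  have "inj_on ((`) f) \<B>"
    using inj_on_subset[OF inj_on_image_Pow[OF f] sub] .
  then have eq: "card ((`) f ` \<B>) = card \<B>" by (rule card_image)
  have "card ((`) f ` \<B>) \<in> {card \<B> | (X :: nat set) \<B>. traceability_scheme t w v X \<B>}"
    using traceability_scheme_image[OF ts f] by blast
  from Max_ge[OF finite_TS_sizes this] show ?thesis
    unfolding max_TS_size_def eq .
qed

end

theory Submission imports Defs "HOL-Combinatorics.Permutations" "HOL-Number_Theory.Cong"
begin

text \<open>
  A \<open>t\<close>-traceability scheme is \<open>t\<^sup>2\<close>-cover-free. If \<open>B\<close> is covered by at most \<open>t\<^sup>2\<close> other blocks,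
  averaging over the \<open>t\<close>-subsets of the cover yields \<open>t\<close> blocks \<open>A\<close> in \<open>J\<close> such that, with
  \<open>Y = B \<inter> \<Union>J\<close>, we have \<open>card Y + (\<Sum>A\<in>J. card (Y - A)) \<ge> w\<close>. Enlarging \<open>Y\<close> by \<open>card (Y - A)\<close> points
  private to each \<open>A\<close> gives a pirate set that incriminates \<open>B\<close>; if there are too few private
  points, then at least \<open>w\<close> points lie in two or more of the blocks, and any \<open>w\<close> of these
  incriminate an innocent block.

  Let \<open>k\<close> be the least integer with \<open>k t\<^sup>2 \<ge> w\<close>, and call a \<open>k\<close>-subset of a block own if no other
  block contains it. The subsets of \<open>B\<close> that are not own cannot cover \<open>B\<close> by \<open>t\<^sup>2\<close> of them, and
  Katona's cycle method shows that \<open>B\<close> has at least \<open>(w - 1) choose (k - 1)\<close> own subsets. Own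
  subsets of different blocks are distinct.
\<close>

section \<open>Blocks incriminated by at most t others\<close>

text \<open>Enumerating \<open>J\<close> turns the indexed choice of blocks in the definition into a
  set of blocks, the form in which subfamilies are chosen below.\<close>

lemma traceability_schemeD:
  assumes ts: "traceability_scheme t w v X \<B>"
    and J: "J \<subseteq> \<B>" "finite J" "J \<noteq> {}" "card J \<le> t"
    and T: "T \<subseteq> \<Union>J" "finite T" "card T = w"
    and B: "B \<in> \<B>" "B \<notin> J"
  shows "\<exists>A\<in>J. card (T \<inter> B) < card (T \<inter> A)"
proof -
  obtain C where "bij_betw C {1..card J} J"
    using ex_bij_betw_nat_finite_1[OF J(2)] by blast
  then have C: "C ` {1..card J} = J"
    by (simp add: bij_betw_def)
  have s: "1 \<le> card J" "card J \<le> t"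
    using J by (auto simp: Suc_le_eq card_gt_0_iff)
  have "\<forall>s C T. 1 \<le> s \<longrightarrow> s \<le> t \<longrightarrow> (\<forall>j\<in>{1..s}. C j \<in> \<B>) \<longrightarrow>
        T \<in> nsets (\<Union>j\<in>{1..s}. C j) w \<longrightarrow>
        \<not> (\<exists>B \<in> \<B> - C ` {1..s}. \<forall>j\<in>{1..s::nat}. card (T \<inter> B) \<ge> card (T \<inter> C j))"
    using ts unfolding traceability_scheme_def by (elim conjE)
  from spec[OF spec[OF spec[OF this, of "card J"], of C], of T]
  have "(\<forall>j\<in>{1..card J}. C j \<in> \<B>) \<longrightarrow> T \<in> nsets (\<Union>(C ` {1..card J})) w \<longrightarrow>
      \<not> (\<exists>B \<in> \<B> - C ` {1..card J}. \<forall>D\<in>C ` {1..card J}. card (T \<inter> B) \<ge> card (T \<inter> D))"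
    using s by simp
  moreover have "\<forall>j\<in>{1..card J}. C j \<in> \<B>" using C J(1) by blast
  moreover have "T \<in> nsets (\<Union>J) w" using T by (simp add: nsets_def)
  ultimately show ?thesis
    using B unfolding C by (meson DiffI not_le)
qed

lemma traceability_scheme_weight_less:
  assumes ts: "traceability_scheme t w v X \<B>"
    and B: "B \<in> \<B>" and J: "J \<subseteq> \<B> - {B}" "J \<noteq> {}" "card J \<le> t"
  defines "Y \<equiv> B \<inter> \<Union>J"
  shows "card Y + (\<Sum>A\<in>J. card (Y - A)) < w"
proof (rule ccontr)
  assume "\<not> ?thesis"
  then have heavy: "w \<le> card Y + (\<Sum>A\<in>J. card (Y - A))" by simp
  have fX: "finite X" and BX: "\<B> \<subseteq> Pow X" and Bw: "\<And>A. A \<in> \<B> \<Longrightarrow> card A = w"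
    using ts by (auto simp: traceability_scheme_def set_system_def nsets_def)
  have fB: "finite \<B>" using fX BX finite_subset by blast
  have fA: "finite A" if "A \<in> \<B>" for A using that BX fX finite_subset by blast
  have fJ: "finite J" using J(1) fB finite_subset by blast
  define \<A> where "\<A> = insert B J"
  have A: "\<A> \<subseteq> \<B>" "finite \<A>" "card \<A> = Suc (card J)"
    unfolding \<A>_def using B J fJ by (auto simp: card_insert_if)
  \<comment> \<open>The points lying in at least two of the blocks \<open>B\<close> and
    \<open>J\<close>. Either there are \<open>w\<close> of them, or every block of \<open>J\<close>
    keeps enough points of its own.\<close>
  define D where "D = {x. \<exists>A\<in>\<A>. \<exists>A'\<in>\<A>. A \<noteq> A' \<and> x \<in> A \<and> x \<in> A'}"
  have fD: "finite D"
    by (rule finite_subset[OF _ fX]) (use A BX in \<open>auto simp: D_def\<close>)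
  show False
  proof (cases "w \<le> card D")
    case True
    then obtain T where T: "T \<subseteq> D" "card T = w" "finite T"
      by (rule obtain_subset_with_card_n)
    \<comment> \<open>A point of \<open>D\<close> stays covered when any one block is removed, so the block
        meeting \<open>T\<close> most can be taken as the innocent one.\<close>
    have "Max ((\<lambda>A. card (T \<inter> A)) ` \<A>) \<in> (\<lambda>A. card (T \<inter> A)) ` \<A>"
      by (rule Max_in) (use A in \<open>auto simp: \<A>_def\<close>)
    then obtain I where I: "I \<in> \<A>" "card (T \<inter> I) = Max ((\<lambda>A. card (T \<inter> A)) ` \<A>)"
      by auto
    have max: "card (T \<inter> A') \<le> card (T \<inter> I)" if "A' \<in> \<A>" for A'
      using I(2) A(2) that by simp
    have c: "card (\<A> - {I}) = card J" using A I(1) by simp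
    have "card J \<noteq> 0" using J(2) fJ by simp
    then have ne: "\<A> - {I} \<noteq> {}" using c by (metis card.empty)
    have TI: "T \<subseteq> \<Union>(\<A> - {I})" using T(1) unfolding D_def by blast
    have "\<exists>A\<in>\<A> - {I}. card (T \<inter> I) < card (T \<inter> A)"
      by (rule traceability_schemeD[OF ts])
        (use A I c ne TI T J(3) in auto)
    then show False using max by (meson DiffD1 not_le)
  next
    case False
    have YD: "Y \<subseteq> D" unfolding Y_def D_def \<A>_def using J(1) by blast
    define P where "P = (\<lambda>A. A - \<Union>(\<A> - {A}))"
    have P: "card (Y - A) \<le> card (P A)" if "A \<in> J" for A
    proof -
      have AB: "A \<in> \<B>" using that J by auto
      have "A \<in> \<A>" using that by (simp add: \<A>_def)
      then have "P A = A - A \<inter> D" unfolding P_def D_def by blast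
      then have 1: "card (P A) = w - card (A \<inter> D)"
        using Bw[OF AB] fA[OF AB] by (simp add: card_Diff_subset)
      \<comment> \<open>\<open>A \<inter> D\<close> and \<open>Y - A\<close> are disjoint parts of
        \<open>D\<close>, which here has fewer than \<open>w\<close> points. So the private part
        \<open>P A\<close> has room for \<open>card (Y - A)\<close> points.\<close>
      have "card (A \<inter> D) + card (Y - A) = card (A \<inter> D \<union> (Y - A))"
        by (rule card_Un_disjoint[symmetric]) (use fD YD finite_subset in auto)
      also have "\<dots> \<le> card D" by (rule card_mono[OF fD]) (use YD in auto)
      finally show ?thesis using 1 False by simp
    qed
    have "\<forall>A\<in>J. \<exists>Q. Q \<subseteq> P A \<and> card Q = card (Y - A) \<and> finite Q"
      using P by (meson obtain_subset_with_card_n)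
    then obtain Q where Q: "\<And>A. A \<in> J \<Longrightarrow> Q A \<subseteq> P A" "\<And>A. A \<in> J \<Longrightarrow> card (Q A) = card (Y - A)"
      "\<And>A. A \<in> J \<Longrightarrow> finite (Q A)"
      by metis
    have QA: "Q A \<inter> A' = {}" if "A \<in> J" "A' \<in> \<A>" "A' \<noteq> A" for A A'
      using Q(1)[OF that(1)] that unfolding P_def by blast
    have QA': "Q A \<subseteq> A" if "A \<in> J" for A
      using Q(1)[OF that] unfolding P_def by blast
    define S where "S = (\<Union>A\<in>J. Q A)"
    have fS: "finite S" unfolding S_def using fJ Q(3) by blast
    have "card S = (\<Sum>A\<in>J. card (Q A))" unfolding S_def
    proof (rule card_UN_disjoint[OF fJ])
      show "\<forall>i\<in>J. \<forall>j\<in>J. i \<noteq> j \<longrightarrow> Q i \<inter> Q j = {}"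
        using QA QA' unfolding \<A>_def by blast
    qed (use Q in auto)
    then have cS: "card S = (\<Sum>A\<in>J. card (Y - A))" using Q(2) by simp
    have fY: "finite Y" and Yw: "card Y \<le> w"
      unfolding Y_def using fA[OF B] Bw[OF B] card_mono[of B "B \<inter> \<Union>J"] by auto
    have "w - card Y \<le> card S" using heavy cS by simp
    then obtain S' where S': "S' \<subseteq> S" "card S' = w - card Y" "finite S'"
      by (rule obtain_subset_with_card_n)
    have SB: "S \<inter> B = {}" using QA[of _ B] J(1) unfolding S_def \<A>_def by blast
    \<comment> \<open>\<open>B\<close> contains all of \<open>Y\<close>, while a block
      \<open>A\<close> in \<open>J\<close> gets \<open>card (Y \<inter> A)\<close> points from
      \<open>Y\<close> and at most \<open>card (Y - A)\<close> private ones, hence at most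
      \<open>card Y\<close>. No block of \<open>J\<close> beats \<open>B\<close>.\<close>
    define T where "T = Y \<union> S'"
    have "Y \<inter> S' = {}" using SB S' unfolding Y_def by blast
    then have T: "card T = w" "finite T"
      unfolding T_def using fY S' Yw by (auto simp: card_Un_disjoint)
    have TJ: "T \<subseteq> \<Union>J" unfolding T_def Y_def using S'(1) QA' unfolding S_def by blast
    have "\<exists>A\<in>J. card (T \<inter> B) < card (T \<inter> A)"
      by (rule traceability_schemeD[OF ts]) (use J fJ T TJ B in auto)
    then obtain A where AJ: "A \<in> J" and less: "card (T \<inter> B) < card (T \<inter> A)" by blast
    have "Y \<subseteq> T \<inter> B" unfolding T_def Y_def by blast
    then have 1: "card Y \<le> card (T \<inter> B)" using T by (intro card_mono) auto
    have "T \<inter> A \<subseteq> (Y \<inter> A) \<union> Q A"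
      using S'(1) QA AJ unfolding T_def S_def \<A>_def by blast
    then have "card (T \<inter> A) \<le> card ((Y \<inter> A) \<union> Q A)"
      using fY Q(3)[OF AJ] by (intro card_mono) auto
    also have "\<dots> \<le> card (Y \<inter> A) + card (Y - A)"
      using card_Un_le[of "Y \<inter> A" "Q A"] Q(2)[OF AJ] by simp
    also have "\<dots> = card Y" using fY by (metis card_Int_Diff)
    finally show False using 1 less by simp
  qed
qed

section \<open>Averaging over the t-subsets of a cover\<close>

text \<open>Absorption gives the ratio (M - k) / (k + 1) of the two binomials. With t = k + 1 the
  hypothesis reads M \<le> t^2 - 1, which is where the bound t^2 on the size of a cover
  enters.\<close>

lemma binomial_Suc_le_mult:
  assumes "M \<le> Suc k * k + k"
  shows "M choose Suc k \<le> k * (M choose k)"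
proof -
  have "Suc k * (M choose Suc k) = (M - k) * (M choose k)"
    using binomial_absorption[of k M] binomial_absorb_comp[of M k] by metis
  also have "\<dots> \<le> (Suc k * k) * (M choose k)" using assms by (intro mult_right_mono) auto
  finally have "Suc k * (M choose Suc k) \<le> Suc k * (k * (M choose k))" by (simp add: algebra_simps)
  then show ?thesis by (simp only: Suc_mult_le_cancel1)
qed

text \<open>\<open>D\<close> stands for the members of a cover that contain a given point, and the
  summand is the share of that point in the weight of \<open>J\<close>. The claim is that the
  average share is at least 1.\<close>

lemma sum_hitting_weight_ge:
  assumes fC: "finite \<C>" and D: "D \<subseteq> \<C>" "D \<noteq> {}" and N: "card \<C> \<le> t\<^sup>2" and t: "t \<ge> 1"
  shows "card \<C> choose t \<le> (\<Sum>J\<in>nsets \<C> t. if J \<inter> D = {} then 0 else 1 + card (J - D))"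
    (is "_ \<le> sum ?f _")
proof -
  obtain y where y: "y \<in> D" using D by blast
  obtain k where k: "t = Suc k" using t by (cases t) auto
  define M where "M = card (\<C> - D)"
  have fD: "finite D" using D fC finite_subset by blast
  have "card D \<ge> 1" using D fD by (simp add: Suc_le_eq card_gt_0_iff)
  \<comment> \<open>Since \<open>D\<close> is nonempty, \<open>M\<close> is at most t^2 - 1, and
    this equals \<open>Suc k * k + k\<close>.\<close>
  then have "M \<le> Suc k * k + k"
    using N D fD unfolding M_def k by (simp add: card_Diff_subset power2_eq_square)
  then have M: "M choose t \<le> k * (M choose k)" unfolding k by (rule binomial_Suc_le_mult)
  define miss where "miss = nsets (\<C> - D) t"
  \<comment> \<open>The sets missing \<open>D\<close> contribute nothing; the excess of those meeting \<open>D\<close> in \<open>y\<close> only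
      makes up for them.\<close>
  define one where "one = insert y ` nsets (\<C> - D) k"
  have fin: "finite (nsets \<C> t)" using fC by (simp add: finite_imp_finite_nsets)
  have miss: "miss = {J \<in> nsets \<C> t. J \<inter> D = {}}" unfolding miss_def nsets_def by auto
  have cm: "card miss = M choose t" unfolding miss_def M_def by simp
  have "inj_on (insert y) (nsets (\<C> - D) k)"
    by (rule inj_onI) (use y in \<open>auto simp: nsets_def\<close>)
  then have co: "card one = M choose k" unfolding one_def M_def by (simp add: card_image)
  have one: "one \<subseteq> nsets \<C> t - miss"
    unfolding one_def miss using y D by (auto simp: nsets_def k card_insert_if)
  have onek: "card (J - D) = k" if J: "J \<in> one" for J
  proof -
    obtain J' where J': "J = insert y J'" "J' \<in> nsets (\<C> - D) k"
      using J unfolding one_def by blast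
    then have "J - D = J'" using y by (auto simp: nsets_def)
    then show ?thesis using J' by (auto simp: nsets_def)
  qed
  have "card \<C> choose t = card (nsets \<C> t)" by simp
  also have "\<dots> = card miss + card (nsets \<C> t - miss)"
  proof (subst card_Un_disjoint[symmetric])
    show "card (nsets \<C> t) = card (miss \<union> (nsets \<C> t - miss))"
      by (rule arg_cong[of _ _ card]) (auto simp: miss)
  qed (use fin miss in auto)
  also have "\<dots> \<le> k * card one + card (nsets \<C> t - miss)" using M cm co by simp
  also have "k * card one = (\<Sum>J\<in>one. card (J - D))" using onek by simp
  also have "\<dots> \<le> (\<Sum>J\<in>nsets \<C> t - miss. card (J - D))"
    by (rule sum_mono2) (use one fin in auto)
  also have "(\<Sum>J\<in>nsets \<C> t - miss. card (J - D)) + card (nsets \<C> t - miss)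
      = (\<Sum>J\<in>nsets \<C> t - miss. ?f J)"
    by (subst card_eq_sum, subst sum.distrib[symmetric], rule sum.cong) (auto simp: miss)
  also have "\<dots> \<le> sum ?f (nsets \<C> t)"
    by (rule sum_mono2) (use fin in auto)
  finally show ?thesis by simp
qed

text \<open>A cover with at most \<open>t\<close> members serves as \<open>J\<close> itself.
  Otherwise the weight of a \<open>t\<close>-subset is split into the shares \<open>?f J e\<close>
  of the points of \<open>B\<close>; each share averages at least 1, so some \<open>J\<close>
  reaches total weight \<open>card B\<close>.\<close>

lemma exists_heavy_subcover:
  assumes fC: "finite \<C>" and N: "card \<C> \<le> t\<^sup>2" and t: "t \<ge> 1"
    and fB: "finite B" and cov: "B \<subseteq> \<Union>\<C>" and ne: "B \<noteq> {}"
  shows "\<exists>J\<subseteq>\<C>. J \<noteq> {} \<and> card J \<le> t \<and>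
           card B \<le> card (B \<inter> \<Union>J) + (\<Sum>A\<in>J. card (B \<inter> \<Union>J - A))"
proof (cases "card \<C> \<le> t")
  case True
  then show ?thesis using cov ne by (intro exI[of _ \<C>]) (auto simp: Int_absorb2)
next
  case False
  let ?D = "\<lambda>e. {A\<in>\<C>. e \<in> A}"
  let ?f = "\<lambda>J e. if J \<inter> ?D e = {} then 0 else 1 + card (J - ?D e)"
  have wt: "card (B \<inter> \<Union>J) + (\<Sum>A\<in>J. card (B \<inter> \<Union>J - A)) = (\<Sum>e\<in>B. ?f J e)"
    if J: "J \<in> nsets \<C> t" for J
  proof -
    let ?Y = "B \<inter> \<Union>J"
    have fJ: "finite J" and JC: "J \<subseteq> \<C>" using J by (auto simp: nsets_def)
    have "(\<Sum>A\<in>J. card (?Y - A)) = (\<Sum>A\<in>J. \<Sum>e\<in>?Y. if e \<in> A then 0 else 1)"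
    proof (rule sum.cong[OF refl])
      fix A
      have "(\<Sum>e\<in>?Y. if e \<in> A then 0 else 1) = (\<Sum>e\<in>?Y - A. 1 :: nat)"
        by (rule sum.mono_neutral_cong_right) (use fB in auto)
      then show "card (?Y - A) = (\<Sum>e\<in>?Y. if e \<in> A then 0 else 1)" by simp
    qed
    also have "\<dots> = (\<Sum>e\<in>?Y. \<Sum>A\<in>J. if e \<in> A then 0 else 1)" by (rule sum.swap)
    also have "\<dots> = (\<Sum>e\<in>?Y. card (J - ?D e))"
    proof (rule sum.cong[OF refl])
      fix e
      have "(\<Sum>A\<in>J. if e \<in> A then 0 else 1) = (\<Sum>A\<in>J - ?D e. 1 :: nat)"
        by (rule sum.mono_neutral_cong_right) (use fJ JC in auto)
      then show "(\<Sum>A\<in>J. if e \<in> A then 0 else 1) = card (J - ?D e)" by simp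
    qed
    finally have "card ?Y + (\<Sum>A\<in>J. card (?Y - A)) = (\<Sum>e\<in>?Y. 1 + card (J - ?D e))"
      by (simp only: card_eq_sum sum.distrib)
    also have "\<dots> = (\<Sum>e\<in>B. ?f J e)"
      by (rule sum.mono_neutral_cong_left) (use fB JC in auto)
    finally show ?thesis .
  qed
  have "\<exists>J\<in>nsets \<C> t. card B \<le> (\<Sum>e\<in>B. ?f J e)"
  proof (rule ccontr)
    assume "\<not> ?thesis"
    then have less: "(\<Sum>e\<in>B. ?f J e) < card B" if "J \<in> nsets \<C> t" for J
      using that by (meson not_le)
    have pos: "card \<C> choose t > 0" using False by simp
    have ne': "nsets \<C> t \<noteq> {}"
    proof
      assume "nsets \<C> t = {}"
      then have "card (nsets \<C> t) = 0" by simp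
      then show False using pos by simp
    qed
    have "(\<Sum>J\<in>nsets \<C> t. \<Sum>e\<in>B. ?f J e) < (\<Sum>J\<in>nsets \<C> t. card B)"
      by (rule sum_strict_mono) (use fC ne' less in \<open>auto simp: finite_imp_finite_nsets\<close>)
    also have "\<dots> = (\<Sum>e\<in>B. card \<C> choose t)" by simp
    also have "\<dots> \<le> (\<Sum>e\<in>B. \<Sum>J\<in>nsets \<C> t. ?f J e)"
      by (rule sum_mono, rule sum_hitting_weight_ge) (use fC N t cov in auto)
    also have "\<dots> = (\<Sum>J\<in>nsets \<C> t. \<Sum>e\<in>B. ?f J e)" by (rule sum.swap)
    finally show False by simp
  qed
  then obtain J where J: "J \<in> nsets \<C> t" "card B \<le> (\<Sum>e\<in>B. ?f J e)" by blast
  then show ?thesis using wt[OF J(1)] t by (intro exI[of _ J]) (auto simp: nsets_def)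
qed

lemma traceability_scheme_cover_free:
  assumes ts: "traceability_scheme t w v X \<B>" and t: "t \<ge> 1" and w: "w \<ge> 1"
    and B: "B \<in> \<B>" and C: "\<C> \<subseteq> \<B> - {B}" "card \<C> \<le> t\<^sup>2"
  shows "\<not> B \<subseteq> \<Union>\<C>"
proof
  assume cov: "B \<subseteq> \<Union>\<C>"
  have fX: "finite X" and BX: "\<B> \<subseteq> Pow X" and Bw: "card B = w"
    using ts B by (auto simp: traceability_scheme_def set_system_def nsets_def)
  have fB: "finite B" using fX BX B finite_subset by blast
  have "finite \<B>" using fX BX finite_subset by blast
  then have fC: "finite \<C>" using C finite_subset by blast
  have "B \<noteq> {}" using Bw w by auto
  from exists_heavy_subcover[OF fC C(2) t fB cov this]
  obtain J where J: "J \<subseteq> \<C>" "J \<noteq> {}" "card J \<le> t"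
    "card B \<le> card (B \<inter> \<Union>J) + (\<Sum>A\<in>J. card (B \<inter> \<Union>J - A))" by blast
  have "J \<subseteq> \<B> - {B}" using J C by blast
  from traceability_scheme_weight_less[OF ts B this J(2,3)] J(4) Bw show False by simp
qed

section \<open>Katona's cycle method\<close>

text \<open>For each \<open>j\<close> the shift by \<open>j * k\<close> is injective modulo
  \<open>n\<close>, so it sends at most k - 1 starts \<open>c\<close> into \<open>S\<close>.
  Together at most r (k - 1) < n starts are spoiled.\<close>

lemma cyclic_progression_avoiding:
  fixes n k r :: nat
  assumes n: "r * (k - 1) < n" and S: "card S < k" "finite S"
  shows "\<exists>c<n. \<forall>j<r. (c + j * k) mod n \<notin> S"
proof (rule ccontr)
  assume "\<not> ?thesis"
  then have "{..<n} \<subseteq> (\<Union>j<r. {c\<in>{..<n}. (c + j * k) mod n \<in> S})" (is "_ \<subseteq> (\<Union>j<r. ?E j)")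
    by auto
  then have "n \<le> card (\<Union>j<r. ?E j)"
    using card_mono[of "\<Union>j<r. ?E j" "{..<n}"] by simp
  also have "\<dots> \<le> (\<Sum>j<r. card (?E j))" by (rule card_UN_le) simp
  also have "\<dots> \<le> (\<Sum>j<r. k - 1)"
  proof (rule sum_mono)
    fix j
    have "card (?E j) \<le> card S"
    proof (rule card_inj_on_le)
      show "inj_on (\<lambda>c. (c + j * k) mod n) (?E j)"
      proof (rule inj_onI)
        fix c d assume "c \<in> ?E j" "d \<in> ?E j" "(c + j * k) mod n = (d + j * k) mod n"
        then show "c = d"
          using cong_add_rcancel_nat[of c "j * k" d n] by (simp add: cong_def)
      qed
    qed (use S in auto)
    then show "card (?E j) \<le> k - 1" using S by simp
  qed
  finally show False using n by simp
qed

definition cyclic_arc :: "nat \<Rightarrow> nat \<Rightarrow> nat \<Rightarrow> nat set" where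
  "cyclic_arc n k a = (\<lambda>i. (a + i) mod n) ` {..<k}"

lemma cyclic_arc_in_nsets:
  assumes "k \<le> n" "0 < n"
  shows "cyclic_arc n k a \<in> nsets {..<n} k"
proof -
  have "inj_on (\<lambda>i. (a + i) mod n) {..<k}"
  proof (rule inj_onI)
    fix i j assume "i \<in> {..<k}" "j \<in> {..<k}" "(a + i) mod n = (a + j) mod n"
    then show "i = j"
      using cong_add_lcancel_nat[of a i j n] assms by (simp add: cong_def)
  qed
  then show ?thesis
    using assms unfolding cyclic_arc_def nsets_def by (auto simp: card_image)
qed

text \<open>The arcs are laid end to end from \<open>c\<close>, and their total length
  \<open>r * k\<close> suffices for a full turn.\<close>

lemma cyclic_arcs_cover:
  assumes "n \<le> r * k" "c < n"
  shows "{..<n} \<subseteq> (\<Union>j<r. cyclic_arc n k ((c + j * k) mod n))"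
proof
  fix x assume x: "x \<in> {..<n}"
  \<comment> \<open>The offset of \<open>x\<close> from \<open>c\<close> along the cycle: its
    quotient by \<open>k\<close> selects the arc, its remainder the place in the arc.\<close>
  define y where "y = (x + (n - c)) mod n"
  have "y < n" using assms unfolding y_def by simp
  then have "y < r * k" using assms by simp
  then have j: "y div k < r" "y mod k < k"
    by (simp add: less_mult_imp_div_less, cases k) auto
  have "((c + y div k * k) mod n + y mod k) mod n = (c + y) mod n"
    by (simp add: mod_add_left_eq add.assoc)
  also have "\<dots> = (c + (x + (n - c))) mod n" unfolding y_def by (simp add: mod_add_right_eq)
  also have "\<dots> = x" using x assms by simp
  finally have "x \<in> cyclic_arc n k ((c + y div k * k) mod n)"
    unfolding cyclic_arc_def using j(2) by (metis imageI lessThan_iff)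
  then show "x \<in> (\<Union>j<r. cyclic_arc n k ((c + j * k) mod n))" using j(1) by blast
qed

lemma exists_permutes_image_eq:
  assumes "finite W" "A \<subseteq> W" "A' \<subseteq> W" "card A = card A'"
  shows "\<exists>q. q permutes W \<and> q ` A = A'"
proof -
  have fin: "finite A" "finite A'" using assms finite_subset by auto
  obtain f where f: "bij_betw f A A'"
    using finite_same_card_bij[OF fin assms(4)] by blast
  have "card (W - A) = card (W - A')" using assms fin by (simp add: card_Diff_subset)
  then obtain g where g: "bij_betw g (W - A) (W - A')"
    using finite_same_card_bij[of "W - A" "W - A'"] assms(1) by auto
  define q where "q x = (if x \<in> A then f x else if x \<in> W then g x else x)" for x
  have "bij_betw q A A'"
    using f by (subst bij_betw_cong[where g = f]) (auto simp: q_def)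
  moreover have "bij_betw q (W - A) (W - A')"
    using g by (subst bij_betw_cong[where g = g]) (auto simp: q_def)
  ultimately have "bij_betw q (A \<union> (W - A)) (A' \<union> (W - A'))"
    by (rule bij_betw_combine) auto
  moreover have "A \<union> (W - A) = W" "A' \<union> (W - A') = W" using assms by auto
  ultimately have "bij_betw q W W" by simp
  then have "q permutes W" by (rule bij_imp_permutes) (use assms in \<open>auto simp: q_def\<close>)
  moreover have "q ` A = A'" using \<open>bij_betw q A A'\<close> by (simp add: bij_betw_def)
  ultimately show ?thesis by blast
qed

text \<open>A random permutation sends \<open>A\<close> to a uniformly distributed
  \<open>k\<close>-subset: composing with a permutation that takes \<open>H\<close> to
  \<open>H'\<close> shows that all targets are hit equally often.\<close>

lemma card_permutes_image_in:
  assumes W: "finite W" and A: "A \<in> nsets W k" and H: "\<H> \<subseteq> nsets W k"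
  shows "(card W choose k) * card {p. p permutes W \<and> p ` A \<in> \<H>} = fact (card W) * card \<H>"
proof -
  let ?P = "\<lambda>H. {p. p permutes W \<and> p ` A = H}"
  have finP: "finite (?P H)" for H
    by (rule finite_subset[OF _ finite_permutations[OF W]]) auto
  have le: "card (?P H) \<le> card (?P H')" if HH: "H \<in> nsets W k" "H' \<in> nsets W k" for H H'
  proof -
    obtain q where q: "q permutes W" "q ` H = H'"
      using exists_permutes_image_eq[OF W, of H H'] HH by (auto simp: nsets_def)
    show ?thesis
    proof (rule card_inj_on_le[OF _ _ finP])
      show "inj_on (\<lambda>p. q \<circ> p) (?P H)"
        using fun.inj_map[OF permutes_inj[OF q(1)]] inj_on_subset by blast
      show "(\<lambda>p. q \<circ> p) ` ?P H \<subseteq> ?P H'"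
        using q by (auto intro: permutes_compose simp: image_comp[symmetric])
    qed
  qed
  define K where "K = card (?P A)"
  have K: "card (?P H) = K" if "H \<in> nsets W k" for H
    unfolding K_def using le[OF that A] le[OF A that] by simp
  have cnt: "card {p. p permutes W \<and> p ` A \<in> \<G>} = card \<G> * K" if G: "\<G> \<subseteq> nsets W k" for \<G>
  proof -
    have fG: "finite \<G>" using G W finite_imp_finite_nsets finite_subset by blast
    have "{p. p permutes W \<and> p ` A \<in> \<G>} = (\<Union>H\<in>\<G>. ?P H)" by auto
    then have "card {p. p permutes W \<and> p ` A \<in> \<G>} = (\<Sum>H\<in>\<G>. card (?P H))"
      by (simp only:, intro card_UN_disjoint) (use fG finP in auto)
    also have "\<dots> = (\<Sum>H\<in>\<G>. K)" using K G by (intro sum.cong) auto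
    finally show ?thesis by simp
  qed
  have "p ` A \<in> nsets W k" if "p permutes W" for p
    using A permutes_image[OF that] permutes_inj_on[OF that, of A]
    by (auto simp: nsets_def card_image)
  then have "{p. p permutes W \<and> p ` A \<in> nsets W k} = {p. p permutes W}" by blast
  \<comment> \<open>Taking all \<open>k\<close>-subsets as targets counts every permutation and so
    determines \<open>K\<close>.\<close>
  then have "fact (card W) = (card W choose k) * K"
    using cnt[of "nsets W k"] card_permutations[OF refl W] by simp
  then show ?thesis using cnt[OF H] by simp
qed

text \<open>In each cyclic order, the \<open>n\<close> translates of \<open>r\<close> arcs at distance \<open>k\<close> cover \<open>W\<close>, so each contains
  an arc in \<open>\<H>\<close>; an arc lies in \<open>r\<close> translates, hence at least \<open>n / r > k - 1\<close> arcs are in \<open>\<H>\<close>.\<close>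
lemma card_uncoverable_complement_ge:
  assumes W: "finite W" and k: "k \<le> card W" and r: "r * (k - 1) < card W" "card W \<le> r * k"
    and H: "\<H> \<subseteq> nsets W k"
    and nocover: "\<And>\<F>. \<F> \<subseteq> nsets W k - \<H> \<Longrightarrow> card \<F> \<le> r \<Longrightarrow> \<not> W \<subseteq> \<Union>\<F>"
  shows "(card W - 1) choose (k - 1) \<le> card \<H>"
proof -
  define n where "n = card W"
  have n0: "0 < n" using r unfolding n_def by auto
  have k0: "0 < k" using r by (cases k) auto
  obtain e where e: "bij_betw e {..<n} W"
    using ex_bij_betw_nat_finite[OF W] unfolding n_def by (auto simp: atLeast0LessThan)
  define arc where "arc a = e ` cyclic_arc n k a" for a
  have arc: "arc a \<in> nsets W k" for a
  proof -
    have "cyclic_arc n k a \<in> nsets {..<n} k"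
      using cyclic_arc_in_nsets k n0 unfolding n_def by blast
    then have sub: "cyclic_arc n k a \<subseteq> {..<n}" and "card (cyclic_arc n k a) = k"
      "finite (cyclic_arc n k a)"
      by (simp_all add: nsets_def)
    moreover have "inj_on e (cyclic_arc n k a)"
      using e inj_on_subset sub unfolding bij_betw_def by blast
    moreover have "e ` cyclic_arc n k a \<subseteq> W" using e sub unfolding bij_betw_def by blast
    ultimately show ?thesis unfolding arc_def nsets_def by (simp add: card_image)
  qed
  let ?Perm = "{p. p permutes W}"
  have fP: "finite ?Perm" using W by (rule finite_permutations)
  have ge: "k \<le> card {a\<in>{..<n}. p ` arc a \<in> \<H>}" if p: "p permutes W" for p
  proof (rule ccontr)
    let ?S = "{a\<in>{..<n}. p ` arc a \<in> \<H>}"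
    assume "\<not> k \<le> card ?S"
    then obtain c where c: "c < n" "\<And>j. j < r \<Longrightarrow> (c + j * k) mod n \<notin> ?S"
      using cyclic_progression_avoiding[of r k n ?S] r unfolding n_def by auto
    define \<F> where "\<F> = (\<lambda>j. p ` arc ((c + j * k) mod n)) ` {..<r}"
    have "p ` arc a \<in> nsets W k" for a
      using arc[of a] permutes_image[OF p] permutes_inj_on[OF p, of "arc a"]
      by (auto simp: nsets_def card_image)
    then have "\<F> \<subseteq> nsets W k - \<H>" unfolding \<F>_def using c(2) n0 by auto
    moreover have "card \<F> \<le> r" unfolding \<F>_def using card_image_le[of "{..<r}"] by simp
    moreover have "W \<subseteq> \<Union>\<F>"
    proof -
      have "W = p ` e ` {..<n}" using permutes_image[OF p] e by (simp add: bij_betw_def)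
      also have "\<dots> \<subseteq> p ` e ` (\<Union>j<r. cyclic_arc n k ((c + j * k) mod n))"
        using cyclic_arcs_cover[of n r k c] r c unfolding n_def by (intro image_mono) auto
      also have "\<dots> = \<Union>\<F>" unfolding \<F>_def arc_def by blast
      finally show ?thesis .
    qed
    ultimately show False using nocover by blast
  qed
  have "fact n * k = (\<Sum>p\<in>?Perm. k)" using card_permutations[OF refl W] by (simp add: n_def)
  also have "\<dots> \<le> (\<Sum>p\<in>?Perm. card {a\<in>{..<n}. p ` arc a \<in> \<H>})"
    by (rule sum_mono) (use ge in auto)
  also have "\<dots> = (\<Sum>a<n. card {p\<in>?Perm. p ` arc a \<in> \<H>})"
    by (rule sum_multicount_gen) (use fP in auto)
  finally have "fact n * k \<le> (\<Sum>a<n. card {p\<in>?Perm. p ` arc a \<in> \<H>})" .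
  then have "(n choose k) * (fact n * k) \<le> (n choose k) * (\<Sum>a<n. card {p\<in>?Perm. p ` arc a \<in> \<H>})"
    by (rule mult_left_mono) simp
  also have "\<dots> = (\<Sum>a<n. fact n * card \<H>)"
    unfolding sum_distrib_left
    by (rule sum.cong) (use card_permutes_image_in[OF W arc H] in \<open>simp_all add: n_def\<close>)
  finally have "fact n * (k * (n choose k)) \<le> fact n * (n * card \<H>)" by (simp add: algebra_simps)
  then have "k * (n choose k) \<le> n * card \<H>" by simp
  \<comment> \<open>Absorption turns the density k / n of \<open>\<H>\<close> among the
    \<open>k\<close>-subsets into the stated binomial.\<close>
  moreover have "k * (n choose k) = n * ((n - 1) choose (k - 1))"
    using binomial_absorption[of "k - 1" n] k0 by simp
  ultimately show ?thesis using n0 unfolding n_def by simp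
qed

section \<open>Counting own subsets\<close>

lemma traceability_scheme_size_bound:
  assumes ts: "traceability_scheme t w v X \<B>" and t: "t \<ge> 1"
    and k: "k \<le> w" "t\<^sup>2 * (k - 1) < w" "w \<le> t\<^sup>2 * k"
    and ne: "\<B> \<noteq> {}"
  shows "card \<B> * ((w - 1) choose (k - 1)) + ((w - 1) choose k) \<le> v choose k"
proof -
  have fX: "finite X" and cX: "card X = v" and BX: "\<B> \<subseteq> Pow X" and Bw: "\<And>A. A \<in> \<B> \<Longrightarrow> card A = w"
    using ts by (auto simp: traceability_scheme_def set_system_def nsets_def)
  have fB: "finite \<B>" using fX BX finite_subset by blast
  have fA: "finite A" if "A \<in> \<B>" for A using that BX fX finite_subset by blast
  have w0: "1 \<le> w" using k by simp
  define own where "own B = {T \<in> nsets B k. \<forall>B'\<in>\<B> - {B}. \<not> T \<subseteq> B'}" for B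
  have own_ge: "(w - 1) choose (k - 1) \<le> card (own B)" if B: "B \<in> \<B>" for B
  proof -
    have "(card B - 1) choose (k - 1) \<le> card (own B)"
    proof (rule card_uncoverable_complement_ge[where r = "t\<^sup>2"])
      fix \<F> assume F: "\<F> \<subseteq> nsets B k - own B" "card \<F> \<le> t\<^sup>2"
      \<comment> \<open>Replacing each subset that is not own by another block containing it would
        turn a cover of \<open>B\<close> by such subsets into one by at most t^2 other
        blocks.\<close>
      have "\<forall>T\<in>\<F>. \<exists>B'. B' \<in> \<B> - {B} \<and> T \<subseteq> B'" using F(1) unfolding own_def by blast
      then obtain h where h: "\<And>T. T \<in> \<F> \<Longrightarrow> h T \<in> \<B> - {B}" "\<And>T. T \<in> \<F> \<Longrightarrow> T \<subseteq> h T"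
        by metis
      have "finite \<F>" using F(1) fA[OF B] finite_imp_finite_nsets finite_subset by blast
      then have "card (h ` \<F>) \<le> t\<^sup>2" using card_image_le[of \<F> h] F(2) by simp
      then have "\<not> B \<subseteq> \<Union>(h ` \<F>)"
        using traceability_scheme_cover_free[OF ts t w0 B, of "h ` \<F>"] h(1) by blast
      then show "\<not> B \<subseteq> \<Union>\<F>" using h(2) by blast
    qed (use Bw[OF B] fA[OF B] k in \<open>auto simp: own_def\<close>)
    then show ?thesis using Bw[OF B] by simp
  qed
  have finown: "finite (own B)" if "B \<in> \<B>" for B
    unfolding own_def using fA[OF that] by (simp add: finite_imp_finite_nsets)
  obtain B0 where B0: "B0 \<in> \<B>" using ne by blast
  let ?U = "\<Union>B\<in>\<B> - {B0}. own B"
  have fn: "finite (nsets B0 k)" using fA[OF B0] by (rule finite_imp_finite_nsets)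
  \<comment> \<open>Pascal's rule splits the contribution of \<open>B0\<close> into the share every
    block has and the surplus.\<close>
  have Wk: "w choose k = ((w - 1) choose (k - 1)) + ((w - 1) choose k)"
    using k by (cases w; cases k) auto
  have "(card \<B> - 1) * ((w - 1) choose (k - 1)) = (\<Sum>B\<in>\<B> - {B0}. (w - 1) choose (k - 1))"
    using B0 fB by simp
  also have "\<dots> \<le> (\<Sum>B\<in>\<B> - {B0}. card (own B))" by (rule sum_mono) (use own_ge in auto)
  also have "\<dots> = card ?U"
    by (rule card_UN_disjoint[symmetric]) (use fB finown in \<open>auto simp: own_def nsets_def\<close>)
  finally have U: "(card \<B> - 1) * ((w - 1) choose (k - 1)) \<le> card ?U" .
  \<comment> \<open>All \<open>k\<close>-subsets of \<open>B0\<close> are counted, not only its own ones; this gains the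
      subtracted binomial.\<close>
  have "card ?U + card (nsets B0 k) = card (?U \<union> nsets B0 k)"
    by (rule card_Un_disjoint[symmetric]) (use B0 fB fn finown in \<open>auto simp: own_def nsets_def\<close>)
  also have "\<dots> \<le> card (nsets X k)"
  proof (rule card_mono[OF finite_imp_finite_nsets[OF fX]])
    show "?U \<union> nsets B0 k \<subseteq> nsets X k" using B0 BX by (force simp: own_def nsets_def)
  qed
  finally have "card ?U + (w choose k) \<le> v choose k" using Bw[OF B0] cX by simp
  moreover have "card \<B> * ((w - 1) choose (k - 1))
      = (card \<B> - 1) * ((w - 1) choose (k - 1)) + ((w - 1) choose (k - 1))"
    using B0 fB by (cases "card \<B>") auto
  ultimately show ?thesis using U Wk by simp
qed

theorem mainTheorem2:
  fixes v w t :: nat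
  assumes "v \<ge> w" "w \<ge> t" "t \<ge> 2"
  shows "let k = nat \<lceil>real w / real t ^ 2\<rceil> in
    real (max_TS_size t w v)
      \<le> (real (v choose k) - real ((w - 1) choose k)) / real ((w - 1) choose (k - 1))"
proof -
  define k where "k = nat \<lceil>real w / real t ^ 2\<rceil>"
  have t0: "real t ^ 2 > 0" using assms by simp
  have t1: "t\<^sup>2 \<ge> 1" using assms by simp
  have k0: "k \<ge> 1" using assms t0 unfolding k_def by (simp add: Suc_le_eq)
  have rk: "real k = of_int \<lceil>real w / real t ^ 2\<rceil>" unfolding k_def using assms by simp
  have "real w / real t ^ 2 \<le> real k" unfolding rk by simp
  then have "real w \<le> real (t\<^sup>2 * k)" using t0 by (simp add: field_simps)
  then have wk: "w \<le> t\<^sup>2 * k" by (simp only: of_nat_le_iff)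
  have "real (k - 1) < real w / real t ^ 2" using k0 rk by (simp add: of_nat_diff) linarith
  then have "real (t\<^sup>2 * (k - 1)) < real w" using t0 by (simp add: field_simps)
  then have kw: "t\<^sup>2 * (k - 1) < w" by (simp only: of_nat_less_iff)
  \<comment> \<open>As t^2 \<ge> 1, already k - 1 \<le> t^2 (k - 1) < w.\<close>
  have kle: "k \<le> w" using mult_le_mono1[OF t1, of "k - 1"] kw k0 by linarith
  obtain X :: "nat set" and \<B> where ts: "traceability_scheme t w v X \<B>"
    and max: "card \<B> = max_TS_size t w v"
    using max_TS_size_attained by blast
  have "card \<B> * ((w - 1) choose (k - 1)) + ((w - 1) choose k) \<le> v choose k"
  proof (cases "\<B> = {}")
    case True
    \<comment> \<open>With no block to take as \<open>B0\<close>, the claim reduces to monotonicity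
      of the binomial from w - 1 to v.\<close>
    then show ?thesis using assms binomial_right_mono[of "w - 1" v k] by simp
  next
    case False
    then show ?thesis
      using traceability_scheme_size_bound[OF ts _ kle kw wk] assms by simp
  qed
  then have "real (card \<B> * ((w - 1) choose (k - 1)) + ((w - 1) choose k)) \<le> real (v choose k)"
    by (simp only: of_nat_le_iff)
  moreover have "real ((w - 1) choose (k - 1)) > 0" using kle by simp
  ultimately have "real (card \<B>)
      \<le> (real (v choose k) - real ((w - 1) choose k)) / real ((w - 1) choose (k - 1))"
    by (simp add: pos_le_divide_eq)
  then show ?thesis unfolding max k_def Let_def .
qed

end
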